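(* For every integer $d \ge 1$ there is a constant $C_d > 0$, depending only on $d$, such that the following holds. Let $n \ge k \ge 1$ be integers and let $V = \{v_1, \dots, v_n\}$ be a multi-set of $n$ vectors in $\mathbb{R}^d$ with the property that for any hyperplane $H$ of $\mathbb{R}^d$ through the origin, one has $\mathrm{dist}(v_i, H) \ge 1$ for at least $k$ values of $i = 1, \dots, n$. Then for any unit ball $B \subset \mathbb{R}^d$, $$\mathbf{P}(X_V \in B) \le C_d\, k^{-d/2}.$$
   Context: For a multi-set $V = \{v_1,\dots,v_n\}$ of vectors in $\mathbb{R}^d$, $X_V := \xi_1 v_1 + \dots + \xi_n v_n$, where $\xi_1, \dots, \xi_n$ are i.i.d. Bernoulli random variables, each taking the values $1$ and $-1$ with probability $1/2$ each. $\mathrm{dist}$ denotes Euclidean distance. A hyperplane through the origin is a linear subspace of dimension $d-1$ (for $d=1$, it is $\{0\}$). A unit ball is a closed Euclidean ball of radius $1$ with arbitrary center. *)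

theory Defs
  imports "HOL-Analysis.Analysis" "HOL-Probability.Probability"
begin

definition linear_hyperplane :: "(real ^ 'd) set \<Rightarrow> bool" where
  "linear_hyperplane H \<longleftrightarrow> subspace H \<and> dim H = CARD('d) - 1"

text \<open>The joint law of \<open>\<xi>\<^sub>1, \<dots>, \<xi>\<^sub>n\<close>, i.i.d. and uniform on \<open>{-1, 1}\<close>. The second
  argument of \<open>Pi_pmf\<close> is only the (irrelevant) value of \<open>\<xi>\<close> outside the index set.\<close>

definition iid_signs :: "nat \<Rightarrow> (nat \<Rightarrow> real) pmf" where
  "iid_signs n = Pi_pmf {1..n} 0 (\<lambda>_. pmf_of_set {-1, 1})"

text \<open>The multiset \<open>V\<close> is given by an enumeration \<open>v 1, \<dots>, v n\<close>, repetitions allowed.\<close>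

definition signed_sum :: "nat \<Rightarrow> (nat \<Rightarrow> real ^ 'd) \<Rightarrow> (nat \<Rightarrow> real) \<Rightarrow> real ^ 'd" where
  "signed_sum n v \<xi> = (\<Sum>i=1..n. \<xi> i *\<^sub>R v i)"

end

theory Submission imports Defs begin

text \<open>
  The proof is Fourier analytic. Write \<open>d\<close> for the dimension. The real part of the characteristic
  function of \<open>X - x\<close>, where \<open>X\<close> is the signed sum, is \<open>cos (\<eta> \<bullet> x) * (\<Prod>i. cos (v i \<bullet> \<eta>))\<close>
  (lemma \<open>expectation_cos_signs\<close>), and a smoothing inequality (lemma \<open>smoothing_inequality\<close>) bounds the
  probability of the unit ball around \<open>x\<close> by a constant times the integral of
  \<open>\<Prod>i. \<bar>cos (v i \<bullet> \<eta>)\<bar>\<close> over the unit ball.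

  The hypothesis on hyperplanes says that along every unit vector \<open>e\<close> at least \<open>k\<close> of the \<open>v i\<close> have a
  component of absolute value at least \<open>1\<close>. Hence \<open>m = k div d\<close> disjoint \<open>d\<close>-tuples can be picked greedily
  so that within each tuple every vector has distance at least \<open>1\<close> from the span of the earlier ones
  (lemma \<open>exists_disjoint_escaping_lists\<close>). After dropping the remaining factors and using
  \<open>\<bar>cos \<theta>\<bar> \<le> exp (- (sin \<theta>)\<^sup>2 / 2)\<close>, the inequality between geometric and arithmetic means bounds the
  product by the average over the tuples of \<open>\<Prod>w. exp (- m (sin (w \<bullet> \<eta>))\<^sup>2 / 2)\<close>, where \<open>w\<close> runs through a
  single tuple (lemma \<open>prod_abs_cos_le_average\<close>).

  For a single tuple each of the \<open>d\<close> factors can be integrated separately, along a direction that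
  the factors of the earlier vectors do not see, and each contributes \<open>O(1 / sqrt m)\<close>
  (lemmas \<open>nn_integral_escaping\<close> and \<open>nn_integral_sin_decay\<close>). The resulting bound \<open>O(m powr (- d / 2))\<close>
  is of the claimed order because \<open>m \<ge> k / (2 d)\<close> once \<open>k \<ge> d\<close>.
\<close>

section \<open>Decay of a one-dimensional oscillatory integral\<close>

lemma abs_sin_ge_half:
  fixes y :: real
  assumes "\<bar>y\<bar> \<le> pi / 2"
  shows "\<bar>y\<bar> / 2 \<le> \<bar>sin y\<bar>"
proof -
  have "\<bar>sin y - y\<bar> \<le> \<bar>y\<bar> ^ 3 / 6"
    using Maclaurin_sin_bound[of y 3] by (simp add: sin_coeff_def eval_nat_numeral)
  moreover have "\<bar>y\<bar> ^ 3 / 6 \<le> \<bar>y\<bar> / 2"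
  proof -
    have "\<bar>y\<bar> \<le> 1.6" using assms pi_approx by simp
    then have "\<bar>y\<bar>\<^sup>2 \<le> 1.6\<^sup>2" by (intro power_mono) auto
    then have "\<bar>y\<bar> * \<bar>y\<bar>\<^sup>2 \<le> \<bar>y\<bar> * 3" by (intro mult_left_mono) (auto simp: power2_eq_square)
    then show ?thesis by (simp add: power3_eq_cube power2_eq_square mult.assoc)
  qed
  ultimately show ?thesis by linarith
qed

text \<open>The only one-dimensional estimate. The integrand is close to \<open>1\<close> only when \<open>b + t a\<close> is within about
  \<open>1 / sqrt m\<close> of a multiple of \<open>\<pi>\<close>. At most \<open>3 \<bar>a\<bar>\<close> multiples of \<open>\<pi>\<close> matter, and around each of them the
  integrand is at most a Gaussian in \<open>t\<close> of standard deviation \<open>2 / (\<bar>a\<bar> sqrt m)\<close>. The factors \<open>\<bar>a\<bar>\<close>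
  cancel, so the bound is uniform in \<open>a\<close> and \<open>b\<close>.\<close>

lemma nn_integral_sin_decay:
  fixes a b m :: real
  assumes a: "1 \<le> \<bar>a\<bar>" and m: "0 < m"
  shows "(\<integral>\<^sup>+t\<in>{0..1}. ennreal (exp (- (m * (sin (b + t * a))\<^sup>2 / 2))) \<partial>lborel) \<le> ennreal (18 / sqrt m)"
proof -
  \<comment> \<open>\<open>J\<close> collects the multiples of \<open>\<pi>\<close> that are nearest to some point \<open>b + t a\<close> with \<open>t \<in> {0..1}\<close>, and
    \<open>g j\<close> is the Gaussian in \<open>t\<close> that peaks where \<open>b + t a = j \<pi>\<close>, scaled to have maximum \<open>1\<close> and hence integral \<open>s\<close>.\<close>
  define \<sigma> where "\<sigma> = 2 / (\<bar>a\<bar> * sqrt m)"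
  define s where "s = sqrt (2 * pi) * \<sigma>"
  define J where "J = {round ((b - \<bar>a\<bar>) / pi)..round ((b + \<bar>a\<bar>) / pi)}"
  define g where "g = (\<lambda>j::int. \<lambda>t. s * normal_density ((j * pi - b) / a) \<sigma> t)"
  have \<sigma>: "0 < \<sigma>" using a m by (auto simp: \<sigma>_def)
  have s: "0 < s" using \<sigma> by (simp add: s_def)
  have g_eq: "g j t = exp (- (m * (b + t * a - j * pi)\<^sup>2 / 8))" for j t
  proof -
    have "a \<noteq> 0" using a by auto
    have "(t - (j * pi - b) / a)\<^sup>2 / (2 * \<sigma>\<^sup>2) = m * (b + t * a - j * pi)\<^sup>2 / 8"
    proof -
      have "t - (j * pi - b) / a = (b + t * a - j * pi) / a"
        using \<open>a \<noteq> 0\<close> by (simp add: field_simps)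
      then show ?thesis
        using \<open>a \<noteq> 0\<close> m by (simp add: \<sigma>_def power_divide power_mult_distrib field_simps)
    qed
    moreover have "s * (1 / sqrt (2 * pi * \<sigma>\<^sup>2)) = 1"
      using \<sigma> by (simp add: s_def real_sqrt_mult)
    ultimately show ?thesis
      using s by (simp add: g_def normal_density_def)
  qed
  have pointwise: "exp (- (m * (sin (b + t * a))\<^sup>2 / 2)) \<le> (\<Sum>j\<in>J. g j t)" if t: "t \<in> {0..1}" for t
  proof -
    define \<theta> where "\<theta> = b + t * a"
    define j where "j = round (\<theta> / pi)"
    have "\<bar>t * a\<bar> \<le> \<bar>a\<bar>" using t by (auto simp: abs_mult mult_left_le_one_le)
    then have "b - \<bar>a\<bar> \<le> \<theta>" "\<theta> \<le> b + \<bar>a\<bar>" by (auto simp: \<theta>_def)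
    then have j: "j \<in> J"
      unfolding J_def j_def by (auto intro!: round_mono divide_right_mono)
    have "\<bar>\<theta> - j * pi\<bar> = pi * \<bar>j - \<theta> / pi\<bar>"
      by (simp add: abs_mult[of pi, symmetric, simplified] abs_minus_commute algebra_simps)
    also have "\<dots> \<le> pi * (1 / 2)"
      unfolding j_def by (intro mult_left_mono of_int_round_abs_le) auto
    finally have "\<bar>\<theta> - j * pi\<bar> / 2 \<le> \<bar>sin (\<theta> - j * pi)\<bar>"
      by (intro abs_sin_ge_half) simp
    also have "\<bar>sin (\<theta> - j * pi)\<bar> = \<bar>sin \<theta>\<bar>"
      using sin_npi_int[of j] cos_npi_int[of j]
      by (simp add: sin_diff abs_mult mult.commute)
    finally have "(\<bar>\<theta> - j * pi\<bar> / 2)\<^sup>2 \<le> \<bar>sin \<theta>\<bar>\<^sup>2"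
      by (rule power_mono) simp
    then have "(\<theta> - j * pi)\<^sup>2 / 4 \<le> (sin \<theta>)\<^sup>2"
      by (simp add: power_divide)
    then have "m / 2 * ((\<theta> - j * pi)\<^sup>2 / 4) \<le> m / 2 * (sin \<theta>)\<^sup>2"
      using m by (intro mult_left_mono) auto
    then have "exp (- (m * (sin \<theta>)\<^sup>2 / 2)) \<le> g j t"
      by (simp add: g_eq \<theta>_def)
    also have "\<dots> \<le> (\<Sum>j\<in>J. g j t)"
      using j by (intro member_le_sum) (auto simp: J_def g_eq)
    finally show ?thesis by (simp add: \<theta>_def)
  qed
  have "(\<integral>\<^sup>+t\<in>{0..1}. ennreal (exp (- (m * (sin (b + t * a))\<^sup>2 / 2))) \<partial>lborel)
      \<le> (\<integral>\<^sup>+t. (\<Sum>j\<in>J. ennreal (g j t)) \<partial>lborel)"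
  proof (intro nn_integral_mono)
    fix t
    show "ennreal (exp (- (m * (sin (b + t * a))\<^sup>2 / 2))) * indicator {0..1} t \<le> (\<Sum>j\<in>J. ennreal (g j t))"
      using pointwise[of t] by (auto split: split_indicator simp: g_eq ennreal_leI)
  qed
  also have "\<dots> = (\<Sum>j\<in>J. \<integral>\<^sup>+t. ennreal (g j t) \<partial>lborel)"
    by (intro nn_integral_sum) (auto simp: g_def)
  also have "\<dots> = (\<Sum>j\<in>J. ennreal s)"
  proof (intro sum.cong refl)
    fix j
    have "(\<integral>\<^sup>+t. ennreal (g j t) \<partial>lborel) = ennreal (\<integral>t. g j t \<partial>lborel)"
      using \<sigma> s unfolding g_def by (intro nn_integral_eq_integral AE_I2) auto
    then show "(\<integral>\<^sup>+t. ennreal (g j t) \<partial>lborel) = ennreal s"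
      using \<sigma> by (simp add: g_def)
  qed
  also have "\<dots> = ennreal (real (card J) * s)"
    using s by (simp add: ennreal_mult ennreal_of_nat_eq_real_of_nat)
  also have "\<dots> \<le> ennreal (18 / sqrt m)"
  proof (intro ennreal_leI)
    have "round ((b - \<bar>a\<bar>) / pi) \<le> round ((b + \<bar>a\<bar>) / pi)"
      by (intro round_mono divide_right_mono) auto
    then have "real (card J) = real_of_int (round ((b + \<bar>a\<bar>) / pi)) - real_of_int (round ((b - \<bar>a\<bar>) / pi)) + 1"
      by (simp add: J_def)
    also have "\<dots> \<le> (b + \<bar>a\<bar>) / pi - (b - \<bar>a\<bar>) / pi + 2"
      using of_int_round_le[of "(b + \<bar>a\<bar>) / pi"] of_int_round_ge[of "(b - \<bar>a\<bar>) / pi"] by linarith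
    also have "\<dots> = \<bar>a\<bar> * (2 / pi) + 2"
      by (simp add: field_simps)
    also have "\<dots> \<le> \<bar>a\<bar> * 1 + 2 * \<bar>a\<bar>"
      using a pi_approx by (intro add_mono mult_left_mono) auto
    finally have cJ: "real (card J) \<le> 3 * \<bar>a\<bar>" by simp
    have "sqrt (2 * pi) \<le> 3"
      using pi_approx by (intro real_le_lsqrt) auto
    then have "s \<le> 3 * \<sigma>"
      unfolding s_def using \<sigma> by (intro mult_right_mono) auto
    then have "real (card J) * s \<le> (3 * \<bar>a\<bar>) * (3 * \<sigma>)"
      using cJ s by (intro mult_mono) auto
    also have "\<dots> = 18 / sqrt m"
      using a m by (simp add: \<sigma>_def)
    finally show "real (card J) * s \<le> 18 / sqrt m" .
  qed
  finally show ?thesis .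
qed

section \<open>Integrals over lists of vectors that escape each other's span\<close>

text \<open>A list of vectors, read from its end, in which every vector leaves the span of those already read:
  its component along some unit vector orthogonal to that span has absolute value at least \<open>1\<close>.
  Since \<open>e\<close> ranges over unit vectors, this says that the distance from \<open>w\<close> to the span of \<open>ws\<close> is at
  least \<open>1\<close>; the direction is kept because the integral estimate translates along it.\<close>

primrec escaping :: "'a::real_inner list \<Rightarrow> bool" where
  "escaping [] \<longleftrightarrow> True"
| "escaping (w # ws) \<longleftrightarrow>
     escaping ws \<and> (\<exists>e. norm e = 1 \<and> 1 \<le> \<bar>w \<bullet> e\<bar> \<and> (\<forall>u\<in>set ws. u \<bullet> e = 0))"

lemma nn_integral_lborel_translate:
  fixes f :: "'a::euclidean_space \<Rightarrow> ennreal"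
  assumes [measurable]: "f \<in> borel_measurable borel"
  shows "(\<integral>\<^sup>+x. f (c + x) \<partial>lborel) = (\<integral>\<^sup>+x. f x \<partial>lborel)"
proof -
  have "(\<integral>\<^sup>+x. f x \<partial>lborel) = (\<integral>\<^sup>+x. f x \<partial>distr lborel borel ((+) c))"
    by (simp add: lborel_distr_plus)
  also have "\<dots> = (\<integral>\<^sup>+x. f (c + x) \<partial>lborel)"
    by (subst nn_integral_distr) auto
  finally show ?thesis by simp
qed

lemma borel_measurable_prod_list [measurable]:
  fixes f :: "'b \<Rightarrow> 'a \<Rightarrow> real"
  assumes "\<And>w. f w \<in> borel_measurable M"
  shows "(\<lambda>x. \<Prod>w\<leftarrow>ws. f w x) \<in> borel_measurable M"
  using assms by (induction ws) auto

text \<open>Induction on the list: the first vector \<open>w\<close> comes with a unit vector \<open>e\<close> along which the factors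
  of all other vectors are constant. Replacing the integral by its average over the translations
  by \<open>t e\<close>, \<open>t \<in> {0..1}\<close>, costs an enlargement of the radius by \<open>1\<close>; by Tonelli the factor of \<open>w\<close> may then
  be integrated over \<open>t\<close> first, and it contributes \<open>18 / sqrt m\<close>. No change of coordinates is needed.\<close>

lemma nn_integral_escaping:
  fixes ws :: "'a::euclidean_space list"
  assumes "escaping ws" and m: "0 < m"
  shows "(\<integral>\<^sup>+\<eta>\<in>cball 0 r. ennreal (\<Prod>w\<leftarrow>ws. exp (- (m * (sin (w \<bullet> \<eta>))\<^sup>2 / 2))) \<partial>lborel)
    \<le> ennreal (18 / sqrt m) ^ length ws * emeasure lborel (cball (0::'a) (r + length ws))"
  using assms(1)
proof (induction ws arbitrary: r)
  case Nil
  then show ?case by simp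
next
  case (Cons w ws)
  then obtain e where e: "norm e = 1" "1 \<le> \<bar>w \<bullet> e\<bar>" "\<And>u. u \<in> set ws \<Longrightarrow> u \<bullet> e = 0"
    and ws: "escaping ws" by auto
  define f where "f = (\<lambda>\<eta>. exp (- (m * (sin (w \<bullet> \<eta>))\<^sup>2 / 2)))"
  define G where "G = (\<lambda>\<eta>. \<Prod>w\<leftarrow>ws. exp (- (m * (sin (w \<bullet> \<eta>))\<^sup>2 / 2)))"
  define B where "B = cball (0::'a) (r + 1)"
  have [measurable]: "f \<in> borel_measurable borel" "G \<in> borel_measurable borel"
    "B \<in> sets borel" "cball (0::'a) r \<in> sets borel"
    by (auto simp: f_def G_def B_def)
  have nonneg: "0 \<le> f \<eta>" "0 \<le> G \<eta>" for \<eta>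
    by (auto simp: f_def G_def intro!: prod_list_nonneg)
  have inv: "G (t *\<^sub>R e + \<eta>) = G \<eta>" for t \<eta>
    unfolding G_def using e(3) by (intro arg_cong[of _ _ prod_list] map_cong) (auto simp: inner_add_right)
  define L where "L = (\<integral>\<^sup>+\<eta>\<in>cball 0 r. ennreal (f \<eta> * G \<eta>) \<partial>lborel)"
  \<comment> \<open>The ball of radius \<open>r\<close>, translated by \<open>- t e\<close>, stays inside \<open>B\<close>, and \<open>G\<close> does not notice the translation.\<close>
  have shifted: "L \<le> (\<integral>\<^sup>+\<eta>\<in>B. ennreal (f (t *\<^sub>R e + \<eta>)) * ennreal (G \<eta>) \<partial>lborel)"
    if t: "t \<in> {0..1}" for t
  proof -
    have "L = (\<integral>\<^sup>+\<eta>. ennreal (f (t *\<^sub>R e + \<eta>) * G (t *\<^sub>R e + \<eta>)) * indicator (cball 0 r) (t *\<^sub>R e + \<eta>) \<partial>lborel)"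
      unfolding L_def
      by (rule nn_integral_lborel_translate[symmetric, where c = "t *\<^sub>R e"]) measurable
    also have "\<dots> \<le> (\<integral>\<^sup>+\<eta>\<in>B. ennreal (f (t *\<^sub>R e + \<eta>)) * ennreal (G \<eta>) \<partial>lborel)"
    proof (intro nn_integral_mono)
      fix \<eta>
      have "\<eta> \<in> B" if "t *\<^sub>R e + \<eta> \<in> cball 0 r"
        using that t e(1) norm_triangle_ineq4[of "t *\<^sub>R e + \<eta>" "t *\<^sub>R e"] by (auto simp: B_def)
      then show "ennreal (f (t *\<^sub>R e + \<eta>) * G (t *\<^sub>R e + \<eta>)) * indicator (cball 0 r) (t *\<^sub>R e + \<eta>)
        \<le> ennreal (f (t *\<^sub>R e + \<eta>)) * ennreal (G \<eta>) * indicator B \<eta>"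
        using nonneg by (auto simp: inv ennreal_mult split: split_indicator)
    qed
    finally show ?thesis .
  qed
  have "L = (\<integral>\<^sup>+t\<in>{0..1::real}. L \<partial>lborel)"
    by (simp add: nn_integral_cmult_indicator)
  also have "\<dots> \<le> (\<integral>\<^sup>+t\<in>{0..1}. (\<integral>\<^sup>+\<eta>\<in>B. ennreal (f (t *\<^sub>R e + \<eta>)) * ennreal (G \<eta>) \<partial>lborel) \<partial>lborel)"
    by (intro nn_integral_mono) (use shifted in \<open>auto split: split_indicator\<close>)
  also have "\<dots> = (\<integral>\<^sup>+t. (\<integral>\<^sup>+\<eta>. ennreal (f (t *\<^sub>R e + \<eta>)) * ennreal (G \<eta>) * indicator B \<eta> * indicator {0..1} t \<partial>lborel) \<partial>lborel)"
    by (intro nn_integral_cong, subst nn_integral_multc) auto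
  also have "\<dots> = (\<integral>\<^sup>+\<eta>. (\<integral>\<^sup>+t. ennreal (f (t *\<^sub>R e + \<eta>)) * ennreal (G \<eta>) * indicator B \<eta> * indicator {0..1} t \<partial>lborel) \<partial>lborel)"
    by (rule lborel_pair.Fubini') measurable
  also have "\<dots> = (\<integral>\<^sup>+\<eta>. ennreal (G \<eta>) * indicator B \<eta> * (\<integral>\<^sup>+t\<in>{0..1}. ennreal (f (t *\<^sub>R e + \<eta>)) \<partial>lborel) \<partial>lborel)"
    by (intro nn_integral_cong, subst nn_integral_cmult[symmetric]) (auto simp: ac_simps)
  also have "\<dots> \<le> (\<integral>\<^sup>+\<eta>. ennreal (G \<eta>) * indicator B \<eta> * ennreal (18 / sqrt m) \<partial>lborel)"
  proof (intro nn_integral_mono mult_left_mono)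
    fix \<eta>
    show "(\<integral>\<^sup>+t\<in>{0..1}. ennreal (f (t *\<^sub>R e + \<eta>)) \<partial>lborel) \<le> ennreal (18 / sqrt m)"
      using nn_integral_sin_decay[OF e(2) m, of "w \<bullet> \<eta>"]
      by (simp add: f_def inner_add_right add.commute)
  qed auto
  also have "\<dots> = (\<integral>\<^sup>+\<eta>\<in>B. ennreal (G \<eta>) \<partial>lborel) * ennreal (18 / sqrt m)"
    by (rule nn_integral_multc) auto
  also have "\<dots> \<le> (ennreal (18 / sqrt m) ^ length ws * emeasure lborel (cball (0::'a) (r + 1 + length ws))) * ennreal (18 / sqrt m)"
    unfolding B_def G_def by (intro mult_right_mono Cons.IH ws) auto
  finally show ?case
    by (simp add: L_def f_def G_def ac_simps)
qed

section \<open>Greedy selection of disjoint escaping lists\<close>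

text \<open>The choice is greedy. As long as fewer than \<open>DIM('a)\<close> vectors have been chosen, there is a unit
  vector \<open>e\<close> orthogonal to all of them, and as long as fewer than \<open>k\<close> indices are used up or excluded,
  some remaining vector has a component of absolute value at least \<open>1\<close> along \<open>e\<close>.\<close>

lemma exists_escaping_list:
  fixes v :: "'i \<Rightarrow> 'a::euclidean_space"
  assumes "finite I" and spread: "\<And>e. norm e = 1 \<Longrightarrow> k \<le> card {i\<in>I. 1 \<le> \<bar>v i \<bullet> e\<bar>}"
    and "finite J" "card J + r \<le> k" "r \<le> DIM('a)"
  shows "\<exists>js. distinct js \<and> set js \<subseteq> I - J \<and> length js = r \<and> escaping (map v js)"
  using assms(4,5)
proof (induction r)
  case 0
  then show ?case by (intro exI[of _ "[]"]) auto
next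
  case (Suc r)
  then obtain js where js: "distinct js" "set js \<subseteq> I - J" "length js = r" "escaping (map v js)"
    by auto
  have "dim (set (map v js)) \<le> card (set (map v js))"
    by (rule dim_le_card') simp
  also have "\<dots> \<le> r"
    using card_length[of "map v js"] js(3) by simp
  finally have "dim (set (map v js)) < DIM('a)"
    using Suc.prems by simp
  then obtain x where x: "x \<noteq> 0" "\<And>y. y \<in> span (set (map v js)) \<Longrightarrow> orthogonal x y"
    using orthogonal_to_subspace_exists by blast
  define e where "e = x /\<^sub>R norm x"
  have e: "norm e = 1" using x(1) by (simp add: e_def)
  have orth: "u \<bullet> e = 0" if "u \<in> set (map v js)" for u
    using x(2)[OF span_base[OF that]] by (simp add: e_def orthogonal_def inner_commute)
  have "card (J \<union> set js) < card {i\<in>I. 1 \<le> \<bar>v i \<bullet> e\<bar>}"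
    using card_Un_le[of J "set js"] card_length[of js] js(3) Suc.prems(1) spread[OF e] by linarith
  then have "\<not> {i\<in>I. 1 \<le> \<bar>v i \<bullet> e\<bar>} \<subseteq> J \<union> set js"
    using card_mono[of "J \<union> set js" "{i\<in>I. 1 \<le> \<bar>v i \<bullet> e\<bar>}"] \<open>finite J\<close> by auto
  then obtain i where "i \<in> I" "1 \<le> \<bar>v i \<bullet> e\<bar>" "i \<notin> J" "i \<notin> set js" by auto
  then show ?case
    using js e orth by (intro exI[of _ "i # js"]) auto
qed

lemma exists_disjoint_escaping_lists:
  fixes v :: "'i \<Rightarrow> 'a::euclidean_space"
  assumes "finite I" and "\<And>e. norm e = 1 \<Longrightarrow> k \<le> card {i\<in>I. 1 \<le> \<bar>v i \<bullet> e\<bar>}"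
    and "m * DIM('a) \<le> k"
  shows "\<exists>L :: nat \<Rightarrow> 'i list. disjoint_family_on (\<lambda>t. set (L t)) {..<m} \<and>
    (\<forall>t<m. distinct (L t) \<and> set (L t) \<subseteq> I \<and> length (L t) = DIM('a) \<and> escaping (map v (L t)))"
  using assms(3)
proof (induction m)
  case 0
  then show ?case by (auto simp: disjoint_family_on_def)
next
  case (Suc m)
  then obtain L :: "nat \<Rightarrow> 'i list" where L: "disjoint_family_on (\<lambda>t. set (L t)) {..<m}"
    "\<And>t. t < m \<Longrightarrow> distinct (L t) \<and> set (L t) \<subseteq> I \<and> length (L t) = DIM('a) \<and> escaping (map v (L t))"
    by auto
  define J where "J = (\<Union>t<m. set (L t))"
  have "card J \<le> (\<Sum>t<m. card (set (L t)))"
    unfolding J_def by (rule card_UN_le) simp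
  also have "\<dots> \<le> (\<Sum>t<m. DIM('a))"
    using L(2) by (intro sum_mono) (metis card_length lessThan_iff)
  finally have "card J + DIM('a) \<le> k"
    using Suc.prems by simp
  then obtain js where js: "distinct js" "set js \<subseteq> I - J" "length js = DIM('a)" "escaping (map v js)"
    using exists_escaping_list[OF assms(1,2), of J "DIM('a)"] by (auto simp: J_def)
  have "disjoint_family_on (\<lambda>t. set ((L(m := js)) t)) {..<Suc m}"
    using L(1) js(2) unfolding disjoint_family_on_def J_def by (auto simp: less_Suc_eq) blast+
  then show ?case
    using L(2) js by (intro exI[of _ "L(m := js)"]) (auto simp: less_Suc_eq)
qed

section \<open>Reduction of the cosine product to a single list\<close>

lemma abs_cos_le_exp_sin: "\<bar>cos \<theta>\<bar> \<le> exp (- ((sin \<theta>)\<^sup>2 / 2))" for \<theta> :: real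
proof (rule power2_le_imp_le)
  have "\<bar>cos \<theta>\<bar>\<^sup>2 = 1 + - (sin \<theta>)\<^sup>2"
    by (simp add: cos_squared_eq)
  also have "\<dots> \<le> exp (- (sin \<theta>)\<^sup>2)"
    by (rule exp_ge_add_one_self)
  also have "\<dots> = (exp (- ((sin \<theta>)\<^sup>2 / 2)))\<^sup>2"
    by (simp flip: exp_double)
  finally show "\<bar>cos \<theta>\<bar>\<^sup>2 \<le> (exp (- ((sin \<theta>)\<^sup>2 / 2)))\<^sup>2" .
qed simp

text \<open>The inequality between geometric and arithmetic means of the \<open>exp (S t) ^ m\<close>; it plays the role of
  Hoelder's inequality and lets the lists be treated one at a time.\<close>

lemma prod_exp_le_average:
  fixes S :: "nat \<Rightarrow> real"
  assumes "0 < m"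
  shows "(\<Prod>t<m. exp (S t)) \<le> (\<Sum>t<m. exp (real m * S t)) / real m"
proof -
  have "exp (\<Sum>t<m. (1 / real m) *\<^sub>R (real m * S t)) \<le> (\<Sum>t<m. (1 / real m) * exp (real m * S t))"
    using assms by (intro convex_on_sum[OF _ _ exp_convex]) (auto simp: lessThan_empty_iff)
  then show ?thesis
    using assms by (simp add: exp_sum sum_divide_distrib)
qed

lemma prod_abs_cos_le_average:
  fixes v :: "'i \<Rightarrow> 'a::real_inner" and L :: "nat \<Rightarrow> 'i list"
  assumes I: "finite I" and m: "0 < m" and disj: "disjoint_family_on (\<lambda>t. set (L t)) {..<m}"
    and L: "\<And>t. t < m \<Longrightarrow> distinct (L t) \<and> set (L t) \<subseteq> I"
  shows "(\<Prod>i\<in>I. \<bar>cos (v i \<bullet> \<eta>)\<bar>)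
    \<le> (\<Sum>t<m. \<Prod>w\<leftarrow>map v (L t). exp (- (real m * (sin (w \<bullet> \<eta>))\<^sup>2 / 2))) / real m"
proof -
  define S where "S = (\<lambda>t. \<Sum>i\<in>set (L t). - ((sin (v i \<bullet> \<eta>))\<^sup>2 / 2))"
  \<comment> \<open>Factors with an index outside all the lists are at most \<open>1\<close>.\<close>
  have "(\<Prod>i\<in>I. \<bar>cos (v i \<bullet> \<eta>)\<bar>) \<le> (\<Prod>i\<in>(\<Union>t<m. set (L t)). \<bar>cos (v i \<bullet> \<eta>)\<bar>)"
  proof -
    have "(\<Prod>i\<in>I. \<bar>cos (v i \<bullet> \<eta>)\<bar>)
      = (\<Prod>i\<in>I - (\<Union>t<m. set (L t)). \<bar>cos (v i \<bullet> \<eta>)\<bar>) * (\<Prod>i\<in>(\<Union>t<m. set (L t)). \<bar>cos (v i \<bullet> \<eta>)\<bar>)"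
      using I L by (intro prod.subset_diff) auto
    also have "\<dots> \<le> 1 * (\<Prod>i\<in>(\<Union>t<m. set (L t)). \<bar>cos (v i \<bullet> \<eta>)\<bar>)"
      by (intro mult_right_mono prod_le_1 prod_nonneg) auto
    finally show ?thesis by simp
  qed
  also have "\<dots> = (\<Prod>t<m. \<Prod>i\<in>set (L t). \<bar>cos (v i \<bullet> \<eta>)\<bar>)"
    using disj by (intro prod.UNION_disjoint) (auto simp: disjoint_family_on_def)
  also have "\<dots> \<le> (\<Prod>t<m. exp (S t))"
    unfolding S_def exp_sum[OF finite_set]
    by (intro prod_mono conjI prod_nonneg abs_cos_le_exp_sin ballI) auto
  also have "\<dots> \<le> (\<Sum>t<m. exp (real m * S t)) / real m"
    by (rule prod_exp_le_average[OF m])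
  also have "(\<Sum>t<m. exp (real m * S t)) = (\<Sum>t<m. \<Prod>w\<leftarrow>map v (L t). exp (- (real m * (sin (w \<bullet> \<eta>))\<^sup>2 / 2)))"
  proof (intro sum.cong refl)
    fix t assume "t \<in> {..<m}"
    then have "distinct (L t)" using L by auto
    have "exp (real m * S t) = (\<Prod>i\<in>set (L t). exp (- (real m * (sin (v i \<bullet> \<eta>))\<^sup>2 / 2)))"
      by (simp add: S_def sum_distrib_left exp_sum)
    also have "\<dots> = (\<Prod>w\<leftarrow>map v (L t). exp (- (real m * (sin (w \<bullet> \<eta>))\<^sup>2 / 2)))"
      using prod.distinct_set_conv_list[OF \<open>distinct (L t)\<close>] by (simp add: comp_def)
    finally show "exp (real m * S t) = \<dots>" .
  qed
  finally show ?thesis .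
qed

lemma nn_integral_prod_cos_le:
  fixes v :: "'i \<Rightarrow> 'a::euclidean_space"
  assumes I: "finite I" and spread: "\<And>e. norm e = 1 \<Longrightarrow> k \<le> card {i\<in>I. 1 \<le> \<bar>v i \<bullet> e\<bar>}"
    and mk: "m * DIM('a) \<le> k" and m: "0 < m"
  shows "(\<integral>\<^sup>+\<eta>\<in>cball 0 1. ennreal (\<Prod>i\<in>I. \<bar>cos (v i \<bullet> \<eta>)\<bar>) \<partial>lborel)
    \<le> ennreal ((18 / sqrt m) ^ DIM('a) * measure lborel (cball (0::'a) (1 + DIM('a))))"
proof -
  obtain L :: "nat \<Rightarrow> 'i list" where disj: "disjoint_family_on (\<lambda>t. set (L t)) {..<m}"
    and L: "\<And>t. t < m \<Longrightarrow> distinct (L t) \<and> set (L t) \<subseteq> I \<and> length (L t) = DIM('a) \<and> escaping (map v (L t))"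
    using exists_disjoint_escaping_lists[OF I spread mk] by blast
  define F where "F = (\<lambda>t \<eta>. \<Prod>w\<leftarrow>map v (L t). exp (- (real m * (sin (w \<bullet> \<eta>))\<^sup>2 / 2)))"
  let ?R = "(18 / sqrt m) ^ DIM('a) * measure lborel (cball (0::'a) (1 + DIM('a)))"
  have F0: "0 \<le> F t \<eta>" for t \<eta>
    unfolding F_def by (intro prod_list_nonneg) auto
  have [measurable]: "F t \<in> borel_measurable borel" for t
    unfolding F_def by measurable
  have [measurable]: "cball (0::'a) 1 \<in> sets borel" by simp
  have F_int: "(\<integral>\<^sup>+\<eta>\<in>cball 0 1. ennreal (F t \<eta>) \<partial>lborel) \<le> ennreal ?R" if "t < m" for t
  proof -
    have "(\<integral>\<^sup>+\<eta>\<in>cball 0 1. ennreal (F t \<eta>) \<partial>lborel)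
        \<le> ennreal (18 / sqrt m) ^ length (map v (L t)) * emeasure lborel (cball (0::'a) (1 + real (length (map v (L t)))))"
      unfolding F_def using L[OF that] m by (intro nn_integral_escaping) auto
    also have "\<dots> = ennreal ?R"
      using L[OF that] emeasure_lborel_cball_finite[of "0::'a" "1 + DIM('a)"]
      by (simp add: ennreal_mult ennreal_power emeasure_eq_ennreal_measure)
    finally show ?thesis .
  qed
  have "(\<integral>\<^sup>+\<eta>\<in>cball 0 1. ennreal (\<Prod>i\<in>I. \<bar>cos (v i \<bullet> \<eta>)\<bar>) \<partial>lborel)
      \<le> (\<integral>\<^sup>+\<eta>. (\<Sum>t<m. ennreal (1 / m) * (ennreal (F t \<eta>) * indicator (cball 0 1) \<eta>)) \<partial>lborel)"
  proof (intro nn_integral_mono)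
    fix \<eta>
    have "(\<Prod>i\<in>I. \<bar>cos (v i \<bullet> \<eta>)\<bar>) \<le> (\<Sum>t<m. F t \<eta>) / m"
      unfolding F_def using L by (intro prod_abs_cos_le_average I m disj) auto
    also have "\<dots> = (\<Sum>t<m. 1 / m * F t \<eta>)"
      by (simp add: sum_divide_distrib)
    finally have "ennreal (\<Prod>i\<in>I. \<bar>cos (v i \<bullet> \<eta>)\<bar>) \<le> ennreal (\<Sum>t<m. 1 / m * F t \<eta>)"
      by (rule ennreal_leI)
    also have "\<dots> = (\<Sum>t<m. ennreal (1 / m * F t \<eta>))"
      using F0 by (intro sum_ennreal[symmetric] mult_nonneg_nonneg) auto
    also have "\<dots> = (\<Sum>t<m. ennreal (1 / m) * ennreal (F t \<eta>))"
      using F0 by (intro sum.cong refl ennreal_mult) auto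
    finally show "ennreal (\<Prod>i\<in>I. \<bar>cos (v i \<bullet> \<eta>)\<bar>) * indicator (cball 0 1) \<eta>
        \<le> (\<Sum>t<m. ennreal (1 / m) * (ennreal (F t \<eta>) * indicator (cball 0 1) \<eta>))"
      by (auto split: split_indicator)
  qed
  also have "\<dots> = (\<Sum>t<m. ennreal (1 / m) * (\<integral>\<^sup>+\<eta>\<in>cball 0 1. ennreal (F t \<eta>) \<partial>lborel))"
    by (subst nn_integral_sum, measurable, intro sum.cong refl nn_integral_cmult, measurable)
  also have "\<dots> \<le> (\<Sum>t<m. ennreal (1 / m) * ennreal ?R)"
    using F_int by (intro sum_mono mult_left_mono) auto
  also have "\<dots> = (\<Sum>t<m. ennreal (1 / m * ?R))"
    by (intro sum.cong refl ennreal_mult[symmetric]) auto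
  also have "\<dots> = ennreal (\<Sum>t<m. 1 / m * ?R)"
    by (intro sum_ennreal) auto
  also have "\<dots> = ennreal ?R"
    using m by simp
  finally show ?thesis .
qed

section \<open>The characteristic function of a random signed sum\<close>

lemma finite_set_Pi_signs: "finite A \<Longrightarrow> finite (set_pmf (Pi_pmf A (0::real) (\<lambda>_. pmf_of_set {-1, 1})))"
  by (simp add: set_Pi_pmf finite_PiE_dflt)

text \<open>The real part of the characteristic function of a random signed sum; the phase \<open>c\<close> absorbs the terms
  split off in the induction.\<close>

lemma expectation_cos_signs:
  fixes a :: "'i \<Rightarrow> real"
  assumes "finite A"
  shows "measure_pmf.expectation (Pi_pmf A 0 (\<lambda>_. pmf_of_set {-1, 1})) (\<lambda>\<xi>. cos ((\<Sum>i\<in>A. \<xi> i * a i) + c))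
    = cos c * (\<Prod>i\<in>A. cos (a i))"
  using assms
proof (induction A arbitrary: c)
  case empty
  then show ?case by simp
next
  case (insert x A)
  let ?P = "Pi_pmf A 0 (\<lambda>_. pmf_of_set {-1, 1 :: real})"
  have "measure_pmf.expectation (Pi_pmf (insert x A) 0 (\<lambda>_. pmf_of_set {-1, 1}))
          (\<lambda>\<xi>. cos ((\<Sum>i\<in>insert x A. \<xi> i * a i) + c))
      = (\<Sum>y\<in>{-1, 1}. measure_pmf.expectation (?P \<bind> (\<lambda>\<xi>. return_pmf (\<xi>(x := y))))
          (\<lambda>\<xi>. cos ((\<Sum>i\<in>insert x A. \<xi> i * a i) + c)) /\<^sub>R real (card {-1, 1::real}))"
    unfolding Pi_pmf_insert'[OF insert.hyps]
    using insert.hyps finite_set_Pi_signs[of A] by (intro pmf_expectation_bind_pmf_of_set) auto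
  also have "\<dots> = (\<Sum>y\<in>{-1, 1}. measure_pmf.expectation ?P (\<lambda>\<xi>. cos ((\<Sum>i\<in>A. \<xi> i * a i) + (y * a x + c))) / 2)"
  proof (intro sum.cong refl)
    fix y :: real
    have "(\<Sum>i\<in>A. (if i = x then y else \<xi> i) * a i) = (\<Sum>i\<in>A. \<xi> i * a i)" for \<xi> :: "'i \<Rightarrow> real"
      using insert.hyps by (intro sum.cong) auto
    then show "measure_pmf.expectation (?P \<bind> (\<lambda>\<xi>. return_pmf (\<xi>(x := y))))
          (\<lambda>\<xi>. cos ((\<Sum>i\<in>insert x A. \<xi> i * a i) + c)) /\<^sub>R real (card {-1, 1::real})
      = measure_pmf.expectation ?P (\<lambda>\<xi>. cos ((\<Sum>i\<in>A. \<xi> i * a i) + (y * a x + c))) / 2"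
      using insert.hyps by (simp flip: map_pmf_def add: ac_simps)
  qed
  also have "\<dots> = (\<Sum>y\<in>{-1, 1}. cos (y * a x + c) * (\<Prod>i\<in>A. cos (a i)) / 2)"
    by (simp only: insert.IH)
  also have "\<dots> = cos c * (\<Prod>i\<in>insert x A. cos (a i))"
    using insert.hyps by (simp add: cos_add cos_diff field_simps)
  finally show ?case .
qed

section \<open>Smoothing\<close>

text \<open>An inequality of Esseen type: a small ball probability is bounded by the integral of the
  characteristic function over a ball. Let \<open>\<xi>\<close> and \<open>\<xi>'\<close> be independent and uniform on \<open>cball 0 (1/2)\<close>.
  The expectation of \<open>cos ((\<xi> - \<xi>') \<bullet> y)\<close> equals \<open>C y ^ 2 + S y ^ 2\<close>, where \<open>C y\<close> and \<open>S y\<close> are the expectations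
  of \<open>cos (\<xi> \<bullet> y)\<close> and \<open>sin (\<xi> \<bullet> y)\<close>. It is therefore nonnegative for every \<open>y\<close>, and at least
  \<open>(cos (1/2))^2\<close> on the unit ball. Only the real part of the characteristic function occurs, because
  this weight is even in \<open>\<xi> - \<xi>'\<close>.\<close>

lemma smoothing_inequality:
  fixes p :: "'b pmf" and Y :: "'b \<Rightarrow> 'a::euclidean_space"
  assumes fin: "finite (set_pmf p)"
    and K: "(\<integral>\<^sup>+\<eta>\<in>cball 0 1. ennreal \<bar>measure_pmf.expectation p (\<lambda>\<omega>. cos (\<eta> \<bullet> Y \<omega>))\<bar> \<partial>lborel) \<le> ennreal K"
      "0 \<le> K"
  shows "(cos (1 / 2))\<^sup>2 * measure_pmf.prob p {\<omega>. Y \<omega> \<in> cball 0 1}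
    \<le> K / measure lborel (cball (0::'a) (1 / 2))"
proof -
  define Q where "Q = cball (0::'a) (1 / 2)"
  define M where "M = uniform_measure lborel Q"
  define g where "g = (\<lambda>\<eta>. measure_pmf.expectation p (\<lambda>\<omega>. cos (\<eta> \<bullet> Y \<omega>)))"
  define C where "C = (\<lambda>y. \<integral>\<xi>. cos (\<xi> \<bullet> y) \<partial>M)"
  define S where "S = (\<lambda>y. \<integral>\<xi>. sin (\<xi> \<bullet> y) \<partial>M)"
  define V where "V = measure lborel Q"
  have V: "0 < V" "emeasure lborel Q = ennreal V"
    unfolding V_def Q_def using content_cball_pos[of "1 / 2" "0::'a"] emeasure_lborel_cball_finite[of "0::'a" "1 / 2"]
    by (auto simp: emeasure_eq_ennreal_measure)
  interpret M: prob_space M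
    unfolding M_def using V by (intro prob_space_uniform_measure) auto
  have sets_M [measurable_cong]: "sets M = sets borel"
    by (simp add: M_def)
  have [measurable]: "Q \<in> sets borel" "cball (0::'a) 1 \<in> sets borel" by (auto simp: Q_def)
  have AE_Q: "AE \<xi> in M. \<xi> \<in> Q"
    unfolding M_def by (intro AE_uniform_measureI) auto
  have g_eq: "g \<eta> = (\<Sum>\<omega>\<in>set_pmf p. cos (\<eta> \<bullet> Y \<omega>) * pmf p \<omega>)" for \<eta>
    unfolding g_def by (intro integral_measure_pmf_real fin)
  have [measurable]: "g \<in> borel_measurable borel"
    unfolding g_eq[abs_def] by measurable
  have trig_int [simp]: "integrable M (\<lambda>\<xi>. cos (\<xi> \<bullet> y))" "integrable M (\<lambda>\<xi>. sin (\<xi> \<bullet> y))" for y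
    by (auto intro!: M.integrable_const_bound[where B = 1])
  have C_ge: "cos (1 / 2) \<le> C y" if "norm y \<le> 1" for y
    unfolding C_def
  proof (intro M.integral_ge_const trig_int)
    show "AE \<xi> in M. cos (1 / 2) \<le> cos (\<xi> \<bullet> y)"
      using AE_Q
    proof eventually_elim
      case (elim \<xi>)
      have "\<bar>\<xi> \<bullet> y\<bar> \<le> norm \<xi> * norm y" by (rule Cauchy_Schwarz_ineq2)
      also have "\<dots> \<le> 1 / 2 * 1" using elim that by (intro mult_mono) (auto simp: Q_def)
      finally have "cos (1 / 2) \<le> cos \<bar>\<xi> \<bullet> y\<bar>"
        using pi_gt3 by (intro cos_monotone_0_pi_le) auto
      then show ?case by simp
    qed
  qed
  have shifted: "(\<integral>\<xi>. g (- \<xi>' + \<xi>) \<partial>M)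
      = (\<Sum>\<omega>\<in>set_pmf p. (C (Y \<omega>) * cos (\<xi>' \<bullet> Y \<omega>) + S (Y \<omega>) * sin (\<xi>' \<bullet> Y \<omega>)) * pmf p \<omega>)" for \<xi>'
    unfolding g_eq C_def S_def
    by (simp add: inner_diff_left cos_diff)
  \<comment> \<open>By \<open>shifted\<close>, averaging over \<open>\<xi>'\<close> turns the mean of \<open>C\<^sup>2 + S\<^sup>2\<close> into a double integral of \<open>g\<close>.\<close>
  have "(cos (1 / 2))\<^sup>2 * measure_pmf.prob p {\<omega>. Y \<omega> \<in> cball 0 1}
      = measure_pmf.expectation p (\<lambda>\<omega>. (cos (1 / 2))\<^sup>2 * indicator {\<omega>. Y \<omega> \<in> cball 0 1} \<omega>)"
    by simp
  also have "\<dots> \<le> measure_pmf.expectation p (\<lambda>\<omega>. (C (Y \<omega>))\<^sup>2 + (S (Y \<omega>))\<^sup>2)"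
  proof (intro integral_mono integrable_measure_pmf_finite fin)
    fix \<omega>
    have "(cos (1 / 2))\<^sup>2 \<le> (C (Y \<omega>))\<^sup>2" if "norm (Y \<omega>) \<le> 1"
      using C_ge[OF that] cos_ge_zero[of "1 / 2"] pi_gt3 by (intro power_mono) auto
    then show "(cos (1 / 2))\<^sup>2 * indicator {\<omega>. Y \<omega> \<in> cball 0 1} \<omega> \<le> (C (Y \<omega>))\<^sup>2 + (S (Y \<omega>))\<^sup>2"
      by (auto split: split_indicator simp: add_increasing2)
  qed
  also have "\<dots> = (\<Sum>\<omega>\<in>set_pmf p. ((C (Y \<omega>))\<^sup>2 + (S (Y \<omega>))\<^sup>2) * pmf p \<omega>)"
    by (intro integral_measure_pmf_real fin)
  also have "\<dots> = (\<integral>\<xi>'. (\<integral>\<xi>. g (- \<xi>' + \<xi>) \<partial>M) \<partial>M)"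
  proof -
    have "(\<integral>\<xi>. cos (\<xi> \<bullet> y) \<partial>M) = C y" "(\<integral>\<xi>. sin (\<xi> \<bullet> y) \<partial>M) = S y" for y
      by (simp_all add: C_def S_def)
    then show ?thesis
      unfolding shifted by (simp add: power2_eq_square)
  qed
  also have "\<dots> \<le> K / V"
  proof (rule M.integral_le_const)
    show "integrable M (\<lambda>\<xi>'. \<integral>\<xi>. g (- \<xi>' + \<xi>) \<partial>M)"
      unfolding shifted by simp
    show "AE \<xi>' in M. (\<integral>\<xi>. g (- \<xi>' + \<xi>) \<partial>M) \<le> K / V"
      using AE_Q
    proof eventually_elim
      case (elim \<xi>')
      have "\<bar>g \<eta>\<bar> \<le> 1" for \<eta>
      proof -
        have "\<bar>g \<eta>\<bar> \<le> (\<Sum>\<omega>\<in>set_pmf p. \<bar>cos (\<eta> \<bullet> Y \<omega>) * pmf p \<omega>\<bar>)"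
          unfolding g_eq by (rule sum_abs)
        also have "\<dots> \<le> (\<Sum>\<omega>\<in>set_pmf p. 1 * pmf p \<omega>)"
          by (intro sum_mono) (auto simp: abs_mult intro!: mult_left_le_one_le)
        also have "\<dots> = 1" using sum_pmf_eq_1[OF fin order_refl] by simp
        finally show ?thesis .
      qed
      then have int: "integrable M (\<lambda>\<xi>. g (- \<xi>' + \<xi>))"
        by (intro M.integrable_const_bound[where B = 1]) auto
      \<comment> \<open>For \<open>\<xi>'\<close> in \<open>Q\<close> the difference \<open>\<xi> - \<xi>'\<close> stays in the unit ball.\<close>
      have "ennreal (\<integral>\<xi>. \<bar>g (- \<xi>' + \<xi>)\<bar> \<partial>M) = (\<integral>\<^sup>+\<xi>. ennreal \<bar>g (- \<xi>' + \<xi>)\<bar> \<partial>M)"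
        using int by (intro nn_integral_eq_integral[symmetric]) auto
      also have "\<dots> = (\<integral>\<^sup>+\<xi>\<in>Q. ennreal \<bar>g (- \<xi>' + \<xi>)\<bar> \<partial>lborel) / emeasure lborel Q"
        unfolding M_def by (intro nn_integral_uniform_measure) auto
      also have "\<dots> \<le> (\<integral>\<^sup>+\<xi>. ennreal \<bar>g (- \<xi>' + \<xi>)\<bar> * indicator (cball 0 1) (- \<xi>' + \<xi>) \<partial>lborel) / emeasure lborel Q"
      proof (intro divide_right_mono_ennreal nn_integral_mono)
        fix \<xi>
        show "ennreal \<bar>g (- \<xi>' + \<xi>)\<bar> * indicator Q \<xi> \<le> ennreal \<bar>g (- \<xi>' + \<xi>)\<bar> * indicator (cball 0 1) (- \<xi>' + \<xi>)"
          using elim norm_triangle_ineq[of "- \<xi>'" \<xi>] by (auto simp: Q_def split: split_indicator)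
      qed
      also have "\<dots> = (\<integral>\<^sup>+\<eta>\<in>cball 0 1. ennreal \<bar>g \<eta>\<bar> \<partial>lborel) / emeasure lborel Q"
        by (intro arg_cong2[where f = divide] refl
          nn_integral_lborel_translate[where f = "\<lambda>\<eta>::'a. ennreal \<bar>g \<eta>\<bar> * indicator (cball 0 1) \<eta>"]) measurable
      also have "\<dots> \<le> ennreal K / ennreal V"
        unfolding V using K(1) by (intro divide_right_mono_ennreal) (simp add: g_def)
      also have "\<dots> = ennreal (K / V)"
        using K(2) V(1) by (rule divide_ennreal)
      finally have "(\<integral>\<xi>. \<bar>g (- \<xi>' + \<xi>)\<bar> \<partial>M) \<le> K / V"
        using K(2) V(1) by (simp add: ennreal_le_iff)
      moreover have "(\<integral>\<xi>. g (- \<xi>' + \<xi>) \<partial>M) \<le> (\<integral>\<xi>. \<bar>g (- \<xi>' + \<xi>)\<bar> \<partial>M)"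
        using int by (intro integral_mono) auto
      ultimately show ?case by simp
    qed
  qed
  finally show ?thesis by (simp add: V_def Q_def)
qed

section \<open>The small ball estimate\<close>

lemma infdist_hyperplane_le:
  fixes e x :: "'a::euclidean_space"
  assumes "norm e = 1"
  shows "infdist x {y. e \<bullet> y = 0} \<le> \<bar>x \<bullet> e\<bar>"
proof -
  have "e \<bullet> e = 1"
    using assms by (simp add: dot_square_norm)
  then have "infdist x {y. e \<bullet> y = 0} \<le> dist x (x - (x \<bullet> e) *\<^sub>R e)"
    by (intro infdist_le) (simp add: inner_diff_right inner_commute)
  then show ?thesis
    using assms by (simp add: dist_norm)
qed

lemma prob_signed_sum_le:
  fixes v :: "nat \<Rightarrow> real ^ 'd"
  assumes spread: "\<And>e. norm e = 1 \<Longrightarrow> k \<le> card {i\<in>{1..n}. 1 \<le> \<bar>v i \<bullet> e\<bar>}"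
    and mk: "m * CARD('d) \<le> k" and m: "0 < m"
  shows "(cos (1 / 2))\<^sup>2 * measure_pmf.prob (iid_signs n) {\<xi>. signed_sum n v \<xi> \<in> cball x 1}
    \<le> (18 / sqrt m) ^ CARD('d) * measure lborel (cball (0 :: real ^ 'd) (1 + CARD('d)))
       / measure lborel (cball (0 :: real ^ 'd) (1 / 2))"
proof -
  define Y where "Y = (\<lambda>\<xi>. signed_sum n v \<xi> - x)"
  have ch: "\<bar>measure_pmf.expectation (iid_signs n) (\<lambda>\<xi>. cos (\<eta> \<bullet> Y \<xi>))\<bar> \<le> (\<Prod>i\<in>{1..n}. \<bar>cos (v i \<bullet> \<eta>)\<bar>)" for \<eta>
  proof -
    have "\<eta> \<bullet> Y \<xi> = (\<Sum>i\<in>{1..n}. \<xi> i * (v i \<bullet> \<eta>)) + - (\<eta> \<bullet> x)" for \<xi>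
      by (simp add: Y_def signed_sum_def inner_diff_right inner_sum_right inner_commute)
    then have "measure_pmf.expectation (iid_signs n) (\<lambda>\<xi>. cos (\<eta> \<bullet> Y \<xi>)) = cos (- (\<eta> \<bullet> x)) * (\<Prod>i\<in>{1..n}. cos (v i \<bullet> \<eta>))"
      unfolding iid_signs_def by (simp only: expectation_cos_signs[OF finite_atLeastAtMost])
    then show ?thesis
      by (auto simp: abs_mult abs_prod intro!: mult_left_le_one_le prod_nonneg)
  qed
  have "(\<integral>\<^sup>+\<eta>\<in>cball 0 1. ennreal \<bar>measure_pmf.expectation (iid_signs n) (\<lambda>\<xi>. cos (\<eta> \<bullet> Y \<xi>))\<bar> \<partial>lborel)
      \<le> (\<integral>\<^sup>+\<eta>\<in>cball 0 1. ennreal (\<Prod>i\<in>{1..n}. \<bar>cos (v i \<bullet> \<eta>)\<bar>) \<partial>lborel)"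
    by (intro nn_integral_mono mult_right_mono ennreal_leI ch) auto
  also have "\<dots> \<le> ennreal ((18 / sqrt m) ^ DIM(real ^ 'd) * measure lborel (cball (0 :: real ^ 'd) (1 + DIM(real ^ 'd))))"
    using mk m by (intro nn_integral_prod_cos_le[OF _ spread]) auto
  finally have "(cos (1 / 2))\<^sup>2 * measure_pmf.prob (iid_signs n) {\<xi>. Y \<xi> \<in> cball 0 1}
      \<le> (18 / sqrt m) ^ DIM(real ^ 'd) * measure lborel (cball (0 :: real ^ 'd) (1 + DIM(real ^ 'd)))
       / measure lborel (cball (0 :: real ^ 'd) (1 / 2))"
    by (intro smoothing_inequality) (auto simp: iid_signs_def finite_set_Pi_signs)
  moreover have "Y \<xi> \<in> cball 0 1 \<longleftrightarrow> signed_sum n v \<xi> \<in> cball x 1" for \<xi>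
    by (simp add: Y_def dist_norm norm_minus_commute)
  ultimately show ?thesis by simp
qed

theorem theorem1p4:
  "\<exists>C>0. \<forall>(n::nat) (k::nat) (v :: nat \<Rightarrow> real ^ 'd).
     1 \<le> k \<and> k \<le> n \<and>
     (\<forall>H. linear_hyperplane H \<longrightarrow> k \<le> card {i \<in> {1..n}. 1 \<le> infdist (v i) H}) \<longrightarrow>
     (\<forall>x. measure_pmf.prob (iid_signs n) {\<xi>. signed_sum n v \<xi> \<in> cball x 1}
            \<le> C * real k powr (- real CARD('d) / 2))"
proof -
  define d where "d = CARD('d)"
  define R where "R = measure lborel (cball (0 :: real ^ 'd) (1 + CARD('d))) / measure lborel (cball (0 :: real ^ 'd) (1 / 2)) / (cos (1 / 2))\<^sup>2"
  define C where "C = sqrt d ^ d + (18 * sqrt (2 * d)) ^ d * R"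
  have d: "0 < d" by (simp add: d_def)
  have cos_pos: "0 < cos (1 / 2 :: real)"
    using pi_gt3 by (intro cos_gt_zero) auto
  have R: "0 \<le> R" by (simp add: R_def)
  have "0 < C"
    using d R by (auto simp: C_def intro!: add_pos_nonneg)
  moreover have "measure_pmf.prob (iid_signs n) {\<xi>. signed_sum n v \<xi> \<in> cball x 1} \<le> C * real k powr (- real CARD('d) / 2)"
    if k: "1 \<le> k" and hyp: "\<And>H. linear_hyperplane H \<Longrightarrow> k \<le> card {i \<in> {1..n}. 1 \<le> infdist (v i) H}"
    for n k x and v :: "nat \<Rightarrow> real ^ 'd"
  proof -
    let ?P = "measure_pmf.prob (iid_signs n) {\<xi>. signed_sum n v \<xi> \<in> cball x 1}"
    have powr_eq: "real k powr (- real CARD('d) / 2) = (1 / sqrt k) ^ d"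
    proof -
      have "real k powr (- real d / 2) = (real k powr (- 1 / 2)) powr real d"
        by (simp add: powr_powr)
      also have "\<dots> = (1 / sqrt k) ^ d"
        using k by (simp add: powr_realpow powr_minus_divide powr_half_sqrt)
      finally show ?thesis by (simp add: d_def)
    qed
    have spread: "k \<le> card {i\<in>{1..n}. 1 \<le> \<bar>v i \<bullet> e\<bar>}" if e: "norm e = 1" for e
    proof -
      have "e \<noteq> 0" using e by auto
      then have "linear_hyperplane {y. e \<bullet> y = 0}"
        unfolding linear_hyperplane_def using dim_hyperplane[of e]
        by (auto simp: subspace_hyperplane)
      then have "k \<le> card {i\<in>{1..n}. 1 \<le> infdist (v i) {y. e \<bullet> y = 0}}"
        by (rule hyp)
      also have "\<dots> \<le> card {i\<in>{1..n}. 1 \<le> \<bar>v i \<bullet> e\<bar>}"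
        using infdist_hyperplane_le[OF e] by (intro card_mono) (auto intro: order_trans)
      finally show ?thesis .
    qed
    have "?P \<le> C * (1 / sqrt k) ^ d"
    \<comment> \<open>For \<open>k < d\<close> the number \<open>k div d\<close> of lists is \<open>0\<close>, but the right-hand side is at least \<open>1\<close>.\<close>
    proof (cases "k < d")
      case True
      have "?P \<le> 1" by simp
      also have "1 \<le> (sqrt d * (1 / sqrt k)) ^ d"
        using True k by (intro one_le_power) simp
      also have "\<dots> \<le> C * (1 / sqrt k) ^ d"
        unfolding power_mult_distrib C_def using R by (intro mult_right_mono) auto
      finally show ?thesis .
    next
      case False
      define m where "m = k div d"
      have m: "0 < m" using False d by (simp add: m_def div_greater_zero_iff)
      have mk: "m * CARD('d) \<le> k" by (simp add: m_def d_def)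
      have "k < (m + 1) * d"
        using d by (simp add: m_def dividend_less_div_times)
      also have "\<dots> \<le> 2 * d * m"
        using m by (cases m) auto
      finally have "real k \<le> real (2 * d * m)"
        by (intro of_nat_mono) simp
      then have "sqrt k \<le> sqrt (2 * d) * sqrt m"
        by (simp flip: real_sqrt_mult)
      then have le: "18 / sqrt m \<le> 18 * sqrt (2 * d) * (1 / sqrt k)"
        using m k by (simp add: field_simps)
      have "(cos (1 / 2))\<^sup>2 * ?P \<le> (cos (1 / 2))\<^sup>2 * ((18 / sqrt m) ^ d * R)"
        using prob_signed_sum_le[OF spread mk m, of x] cos_pos by (simp add: R_def d_def)
      then have "?P \<le> (18 / sqrt m) ^ d * R"
        using cos_pos by simp
      also have "\<dots> \<le> (18 * sqrt (2 * d) * (1 / sqrt k)) ^ d * R"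
        using le R by (intro mult_right_mono power_mono) auto
      also have "\<dots> = (18 * sqrt (2 * d)) ^ d * R * (1 / sqrt k) ^ d"
        by (simp only: power_mult_distrib ac_simps)
      also have "\<dots> \<le> C * (1 / sqrt k) ^ d"
        unfolding C_def by (intro mult_right_mono) auto
      finally show ?thesis .
    qed
    then show ?thesis by (simp only: powr_eq)
  qed
  ultimately show ?thesis by blast
qed

end
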